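(* Let $\mathbf X=(X,\mathcal E)$ be a coarsely locally finite coarse space and let $(\mathfrak A,\mathbb 1_\bullet,\mathcal H)$ be a locally admissible $\mathbf X$-module. Then $\mathfrak A$ and $\mathbb 1_\bullet$ can be extended to define a discrete module; that is, there are a Boolean algebra $\mathfrak A'\supseteq\mathfrak A$ of subsets of $X$ and a unital representation $\mathbb 1'_\bullet\colon\mathfrak A'\to\mathcal B(\mathcal H)$ extending $\mathbb 1_\bullet$ such that $(\mathfrak A',\mathbb 1'_\bullet,\mathcal H)$ is a discrete $\mathbf X$-module.
   Context: Coarse spaces. For relations $E,F\subseteq X\times X$: $E^T=\{(x,y):(y,x)\in E\}$, $E\circ F=\{(z,x):\exists y,(z,y)\in E,(y,x)\in F\}$, $E(A)=\{y:\exists a\in A,(y,a)\in E\}$. A coarse structure on $X$ is a non-empty family $\mathcal E$ of subsets of $X\times X$ (controlled entourages), closed under subsets and finite unions, containing the diagonal $\Delta_X$, and closed under $E\mapsto E^T$ and under composition. A gauge is a symmetric element of $\mathcal E$ containing $\Delta_X$. $A\subseteq X$ is $E$-bounded (or $E$-controlled) if $A\times A\subseteq E$, and bounded if $A\times A\in\mathcal E$. A controlled partition is a partition $X=\bigsqcup_{i\in I}C_i$ such that, for some $E\in\mathcal E$, every $C_i$ is $E$-bounded. A family $(C_i)_{i\in I}$ is locally finite if every bounded $A\subseteq X$ meets only finitely many $C_i$. $\mathbf X$ is coarsely locally finite if it admits a locally finite controlled partition. Modules. A unital representation of a Boolean algebra $\mathfrak A$ of subsets of $X$ with $X\in\mathfrak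 A$ is a map $\mathbb 1_\bullet$ from $\mathfrak A$ to projections (self-adjoint idempotents) of $\mathcal B(\mathcal H)$ with $\mathbb 1_\emptyset=0$, $\mathbb 1_X=1$, $\mathbb 1_{A\cap B}=\mathbb 1_A\mathbb 1_B$, $\mathbb 1_{A\cup B}=\mathbb 1_A+\mathbb 1_B-\mathbb 1_A\mathbb 1_B$. It is an $\mathbf X$-module if it is non-degenerate: for some gauge $\widetilde E$ the subspaces $\mathbb 1_A(\mathcal H)$ with $A\in\mathfrak A$ $\widetilde E$-bounded span a dense subspace of $\mathcal H$. Members of $\mathfrak A$ are called measurable. The module is locally admissible if there is a gauge $\widetilde E$ such that for every bounded $B\subseteq X$ there is $A\in\mathfrak A$ with $B\subseteq A\subseteq\widetilde E(B)$. The module is discrete if there are a gauge $\widetilde E$ and a partition $X=\bigsqcup_{i\in I}A_i$ such that: every $A_i$ is $\widetilde E$-bounded; every $A_i\in\mathfrak A$; $\sum_{i\in I}\mathbb 1_{A_i}=1$ in the strong operator topology; and every $C\subseteq X$ with $C\cap A_i\in\mathfrak A$ for all $i\in I$ belongs to $\mathfrak A$. *)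

theory Defs
  imports "HOL-Analysis.Analysis"
begin

section \<open>Complex Hilbert spaces\<close>

text \<open>
  The inner product is conjugate-linear in its first argument. Its real part is the real inner
  product of the underlying real Hilbert space, so norm, topology and completeness are those of
  the library.
\<close>

class complex_hilbert_space = real_inner + complete_space +
  fixes scaleC :: "complex \<Rightarrow> 'a \<Rightarrow> 'a" (infixr "*\<^sub>C" 75)
    and cinner :: "'a \<Rightarrow> 'a \<Rightarrow> complex"
  assumes scaleC_add_right: "c *\<^sub>C (x + y) = c *\<^sub>C x + c *\<^sub>C y"
    and scaleC_add_left: "(c + d) *\<^sub>C x = c *\<^sub>C x + d *\<^sub>C x"
    and scaleC_scaleC: "c *\<^sub>C d *\<^sub>C x = (c * d) *\<^sub>C x"
    and scaleC_of_real: "complex_of_real r *\<^sub>C x = r *\<^sub>R x"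
    and cinner_commute: "cinner y x = cnj (cinner x y)"
    and cinner_add_right: "cinner x (y + z) = cinner x y + cinner x z"
    and cinner_scaleC_right: "cinner x (c *\<^sub>C y) = c * cinner x y"
    and Re_cinner: "Re (cinner x y) = inner x y"

lemma vector_space_scaleC:
  "vector_space (scaleC :: complex \<Rightarrow> 'a \<Rightarrow> 'a::complex_hilbert_space)"
proof
  fix x :: 'a
  show "1 *\<^sub>C x = x" using scaleC_of_real[of 1 x] by simp
qed (simp_all add: scaleC_add_right scaleC_add_left scaleC_scaleC)

global_interpretation complex_vector:
  vector_space "scaleC :: complex \<Rightarrow> 'a \<Rightarrow> 'a::complex_hilbert_space"
  defines cspan = complex_vector.span
  by (rule vector_space_scaleC)

instantiation complex :: complex_hilbert_space
begin

definition "scaleC c (x::complex) = c * x"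
definition "cinner (x::complex) y = cnj x * y"

instance
  by standard
    (simp_all add: scaleC_complex_def cinner_complex_def algebra_simps scaleR_conv_of_real
      inner_complex_def)

end

text \<open>
  \<^typ>\<open>'h \<Rightarrow>\<^sub>L 'h\<close> consists of the bounded real-linear operators; \<open>complex_linear\<close> cuts out the
  algebra of bounded complex-linear operators.
\<close>

definition complex_linear :: "('h::complex_hilbert_space \<Rightarrow>\<^sub>L 'h) \<Rightarrow> bool"
  where "complex_linear T \<longleftrightarrow> (\<forall>c x. blinfun_apply T (c *\<^sub>C x) = c *\<^sub>C blinfun_apply T x)"

definition self_adjoint :: "('h::complex_hilbert_space \<Rightarrow>\<^sub>L 'h) \<Rightarrow> bool"
  where "self_adjoint T \<longleftrightarrow>
    (\<forall>x y. cinner (blinfun_apply T x) y = cinner x (blinfun_apply T y))"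

definition projection_operator :: "('h::complex_hilbert_space \<Rightarrow>\<^sub>L 'h) \<Rightarrow> bool"
  where "projection_operator T \<longleftrightarrow> complex_linear T \<and> self_adjoint T \<and> T o\<^sub>L T = T"


section \<open>Coarse spaces\<close>

text \<open>
  The transpose and the composition of relations are the library's \<^term>\<open>F\<inverse>\<close> and
  \<^term>\<open>F O G\<close>.
\<close>

locale coarse_space =
  fixes X :: "'a set" and \<E> :: "('a \<times> 'a) set set"
  assumes nonempty: "\<E> \<noteq> {}"
    and entourage_subset: "F \<in> \<E> \<Longrightarrow> F \<subseteq> X \<times> X"
    and subset_closed: "F \<in> \<E> \<Longrightarrow> F' \<subseteq> F \<Longrightarrow> F' \<in> \<E>"
    and Un_closed: "F \<in> \<E> \<Longrightarrow> G \<in> \<E> \<Longrightarrow> F \<union> G \<in> \<E>"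
    and diagonal: "Id_on X \<in> \<E>"
    and converse_closed: "F \<in> \<E> \<Longrightarrow> F\<inverse> \<in> \<E>"
    and relcomp_closed: "F \<in> \<E> \<Longrightarrow> G \<in> \<E> \<Longrightarrow> F O G \<in> \<E>"

definition coarse_gauge :: "'a set \<Rightarrow> ('a \<times> 'a) set set \<Rightarrow> ('a \<times> 'a) set \<Rightarrow> bool"
  where "coarse_gauge X \<E> G \<longleftrightarrow> G \<in> \<E> \<and> sym G \<and> Id_on X \<subseteq> G"

text \<open>The neighbourhood \<open>F(A)\<close>: with this convention it is the image of \<open>A\<close> under the transpose.\<close>

definition thickening :: "('a \<times> 'a) set \<Rightarrow> 'a set \<Rightarrow> 'a set"
  where "thickening F A = {y. \<exists>a\<in>A. (y, a) \<in> F}"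

definition controlled_by :: "('a \<times> 'a) set \<Rightarrow> 'a set \<Rightarrow> bool"
  where "controlled_by F A \<longleftrightarrow> A \<times> A \<subseteq> F"

definition coarsely_bounded :: "('a \<times> 'a) set set \<Rightarrow> 'a set \<Rightarrow> bool"
  where "coarsely_bounded \<E> A \<longleftrightarrow> A \<times> A \<in> \<E>"

definition controlled_partition :: "'a set \<Rightarrow> ('a \<times> 'a) set set \<Rightarrow> 'a set set \<Rightarrow> bool"
  where "controlled_partition X \<E> P \<longleftrightarrow>
    partition_on X P \<and> (\<exists>F\<in>\<E>. \<forall>C\<in>P. controlled_by F C)"

definition locally_finite_family :: "'a set \<Rightarrow> ('a \<times> 'a) set set \<Rightarrow> 'a set set \<Rightarrow> bool"
  where "locally_finite_family X \<E> P \<longleftrightarrow>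
    (\<forall>A\<subseteq>X. coarsely_bounded \<E> A \<longrightarrow> finite {C \<in> P. A \<inter> C \<noteq> {}})"

locale coarsely_locally_finite_space = coarse_space X \<E>
  for X :: "'a set" and \<E> +
  assumes locally_finite_partition:
    "\<exists>P. controlled_partition X \<E> P \<and> locally_finite_family X \<E> P"


section \<open>Coarse modules\<close>

text \<open>
  \<open>\<rho> A\<close> is the projection \<open>1\<^sub>A\<close>; only the values of \<open>\<rho>\<close> on \<open>\<AA>\<close> are meaningful. The
  library locale \<^locale>\<open>algebra\<close> describes Boolean algebras of subsets of \<open>X\<close> that contain \<open>X\<close>.
\<close>

locale unital_representation = algebra X \<AA>
  for X :: "'a set" and \<AA> :: "'a set set" +
  fixes \<rho> :: "'a set \<Rightarrow> ('h::complex_hilbert_space \<Rightarrow>\<^sub>L 'h)"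
  assumes projection: "A \<in> \<AA> \<Longrightarrow> projection_operator (\<rho> A)"
    and rep_empty: "\<rho> {} = 0"
    and rep_space: "\<rho> X = id_blinfun"
    and rep_Int: "A \<in> \<AA> \<Longrightarrow> B \<in> \<AA> \<Longrightarrow> \<rho> (A \<inter> B) = \<rho> A o\<^sub>L \<rho> B"
    and rep_Un: "A \<in> \<AA> \<Longrightarrow> B \<in> \<AA> \<Longrightarrow> \<rho> (A \<union> B) = \<rho> A + \<rho> B - (\<rho> A o\<^sub>L \<rho> B)"

locale coarse_module = coarse_space X \<E> + unital_representation X \<AA> \<rho>
  for X :: "'a set" and \<E> and \<AA> and \<rho> :: "'a set \<Rightarrow> ('h::complex_hilbert_space \<Rightarrow>\<^sub>L 'h)" +
  assumes non_degenerate: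
    "\<exists>G. coarse_gauge X \<E> G \<and>
      closure (cspan (\<Union>A\<in>{A \<in> \<AA>. controlled_by G A}. range (blinfun_apply (\<rho> A)))) = UNIV"

locale locally_admissible_module = coarse_module +
  assumes locally_admissible:
    "\<exists>G. coarse_gauge X \<E> G \<and>
      (\<forall>B\<subseteq>X. coarsely_bounded \<E> B \<longrightarrow> (\<exists>A\<in>\<AA>. B \<subseteq> A \<and> A \<subseteq> thickening G B))"

text \<open>
  Strong convergence of the sum over the partition: \<open>has_sum\<close> is norm convergence, at every
  vector, along the net of finite subfamilies.
\<close>

locale discrete_module = coarse_module +
  assumes discrete:
    "\<exists>G P. coarse_gauge X \<E> G \<and> partition_on X P \<and>
      (\<forall>A\<in>P. controlled_by G A) \<and>
      P \<subseteq> \<AA> \<and>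
      (\<forall>v. ((\<lambda>A. blinfun_apply (\<rho> A) v) has_sum v) P) \<and>
      (\<forall>C\<subseteq>X. (\<forall>A\<in>P. C \<inter> A \<in> \<AA>) \<longrightarrow> C \<in> \<AA>)"

end

theory Submission
  imports Defs
begin

text \<open>
  Well-order a locally finite controlled partition, replace its members by measurable hulls, and
  subtract from each hull the earlier ones. Only finitely many of them matter, so this gives a
  locally finite controlled partition \<open>P\<close> into measurable sets. Let \<open>\<AA>'\<close> consist of the sets
  whose traces on the members of \<open>P\<close> are measurable, and let \<open>\<rho>' C\<close> be the strong limit of the
  projections \<open>\<rho> (C \<inter> \<Union>F)\<close> over finite \<open>F \<subseteq> P\<close>. These nets are eventually constant on the vectors
  fixed by some \<open>\<rho> (\<Union>F)\<close>; such vectors are dense by non-degeneracy and local finiteness, so the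
  limits exist, and \<open>\<rho>' C o\<^sub>L \<rho> (\<Union>F) = \<rho> (C \<inter> \<Union>F)\<close> determines \<open>\<rho>' C\<close>.
\<close>

section \<open>Strong limits of operators\<close>

text \<open>The common bound carries the Cauchy property from the dense set \<open>D\<close> to
  every vector, and completeness then supplies a limit. Linearity and the norm bound survive passage
  to the limit, so the pointwise limits form a bounded operator.\<close>

lemma contraction_net_convergent:
  fixes T :: "'i \<Rightarrow> 'a::real_normed_vector \<Rightarrow>\<^sub>L 'b::{real_normed_vector, complete_space}"
  assumes contr: "\<forall>\<^sub>F i in N. \<forall>v. norm (T i v) \<le> norm v"
    and dense: "closure D = UNIV"
    and conv: "\<And>d. d \<in> D \<Longrightarrow> \<exists>l. ((\<lambda>i. T i d) \<longlongrightarrow> l) N"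
    and N: "N \<noteq> bot"
  shows "\<exists>S. \<forall>v. ((\<lambda>i. T i v) \<longlongrightarrow> blinfun_apply S v) N"
proof -
  have ex: "\<exists>l. ((\<lambda>i. T i v) \<longlongrightarrow> l) N" for v
  proof -
    have "cauchy_filter (filtermap (\<lambda>i. T i v) N)"
      unfolding cauchy_filter_metric_filtermap
    proof (intro allI impI)
      fix e :: real assume e: "e > 0"
      \<comment> \<open>A quarter of \<open>e\<close> is spent on approximating \<open>v\<close> and
        a quarter on the convergence at \<open>d\<close>. This puts \<open>T i v\<close> eventually
        within \<open>e / 2\<close> of \<open>l\<close>, hence any two late values within
        \<open>e\<close> of each other.\<close>
      obtain d where d: "d \<in> D" "dist d v < e / 4"
        using dense e closure_approachable[of v D] by (metis UNIV_I divide_pos_pos zero_less_numeral)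
      obtain l where l: "((\<lambda>i. T i d) \<longlongrightarrow> l) N" using conv d by blast
      have ev: "\<forall>\<^sub>F i in N. dist (T i d) l < e / 4" using l e by (intro tendstoD) auto
      have "\<forall>\<^sub>F i in N. dist (T i v) l < e / 2"
        using ev contr
      proof eventually_elim
        case (elim i)
        have "dist (T i v) (T i d) = norm (T i (v - d))"
          by (simp add: dist_norm blinfun.diff_right)
        also have "\<dots> \<le> dist d v" using elim by (metis dist_commute dist_norm)
        finally show ?case
          using elim d dist_triangle[of "T i v" l "T i d"] by linarith
      qed
      moreover have "dist (T x v) (T y v) < e"
        if "dist (T x v) l < e / 2" "dist (T y v) l < e / 2" for x y
        using that by (rule dist_triangle_half_l)
      ultimately show "\<exists>P. eventually P N \<and> (\<forall>x y. P x \<and> P y \<longrightarrow> dist (T x v) (T y v) < e)"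
        by blast
    qed
    then have "\<exists>c. filtermap (\<lambda>i. T i v) N \<le> nhds c"
      using N by (intro cauchy_filter_complete_converges[of _ UNIV])
        (auto simp: complete_UNIV filtermap_bot_iff)
    then show ?thesis by (simp add: filterlim_def)
  qed
  define f where "f v = (SOME l. ((\<lambda>i. T i v) \<longlongrightarrow> l) N)" for v
  have f: "((\<lambda>i. T i v) \<longlongrightarrow> f v) N" for v
    unfolding f_def by (rule someI_ex) (rule ex)
  have "bounded_linear f"
  proof (rule bounded_linear_intro[where K = 1])
    show "f (x + y) = f x + f y" for x y
      using tendsto_unique[OF N f[of "x + y"]] tendsto_add[OF f[of x] f[of y]]
      by (simp add: blinfun.add_right)
    show "f (r *\<^sub>R x) = r *\<^sub>R f x" for r x
      using tendsto_unique[OF N f[of "r *\<^sub>R x"]] tendsto_scaleR[OF tendsto_const f[of x], of r]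
      by (simp add: blinfun.scaleR_right)
    show "norm (f x) \<le> norm x * 1" for x
    proof -
      have "\<forall>\<^sub>F i in N. norm (T i x) \<le> norm x" using contr by eventually_elim auto
      then show ?thesis using tendsto_upperbound[OF tendsto_norm[OF f[of x]] _ N] by simp
    qed
  qed
  with f show ?thesis
    by (intro exI[of _ "Blinfun f"]) (simp add: bounded_linear_Blinfun_apply)
qed

lemma blinfun_eq_on_dense:
  fixes S T :: "'a::real_normed_vector \<Rightarrow>\<^sub>L 'b::real_normed_vector"
  assumes "closure D = UNIV" and "\<And>d. d \<in> D \<Longrightarrow> S d = T d"
  shows "S = T"
proof (rule blinfun_eqI)
  fix v
  have "closed {v. S v = T v}"
    by (intro closed_Collect_eq) (auto intro!: continuous_intros)
  then have "closure D \<subseteq> {v. S v = T v}"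
    using assms(2) by (intro closure_minimal) auto
  then show "S v = T v" using assms(1) by auto
qed

text \<open>Multiplying the second argument by the imaginary unit turns the imaginary part into
  minus a real part. Questions about the complex inner product thus reduce to the real one, to which
  the continuity rules apply.\<close>

lemma cinner_eq_Complex:
  "cinner x y = Complex (inner x y) (- inner x (\<i> *\<^sub>C y))"
  by (simp add: complex_eq_iff flip: Re_cinner) (simp add: cinner_scaleC_right)

lemma norm_scaleC: "norm (c *\<^sub>C x) = cmod c * norm x"
proof -
  have "cinner (c *\<^sub>C x) (c *\<^sub>C x) = c * (cnj c * cinner x x)"
    using cinner_commute[of "c *\<^sub>C x" x] cinner_commute[of x x, symmetric]
    by (simp add: cinner_scaleC_right)
  also have "\<dots> = complex_of_real ((cmod c)\<^sup>2) * cinner x x"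
    by (simp only: complex_norm_square mult.assoc)
  finally have "inner (c *\<^sub>C x) (c *\<^sub>C x) = (cmod c)\<^sup>2 * inner x x"
    by (simp del: of_real_power flip: Re_cinner)
  then show ?thesis
    by (simp add: norm_eq_sqrt_inner real_sqrt_mult)
qed

text \<open>Multiplication by a complex scalar is therefore continuous and can be exchanged with
  strong limits.\<close>

lemma bounded_linear_scaleC: "bounded_linear (\<lambda>x. c *\<^sub>C x)"
proof (rule bounded_linear_intro[where K = "cmod c"])
  show "c *\<^sub>C (r *\<^sub>R x) = r *\<^sub>R (c *\<^sub>C x)" for r and x :: 'a
    by (simp add: scaleC_scaleC mult.commute flip: scaleC_of_real)
qed (simp_all add: scaleC_add_right norm_scaleC mult.commute)

lemma self_adjoint_if_inner:
  assumes "complex_linear T" and "\<And>x y. inner (T x) y = inner x (T y)"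
  shows "self_adjoint T"
  using assms unfolding self_adjoint_def complex_linear_def by (simp add: cinner_eq_Complex)

lemma self_adjoint_inner:
  assumes "self_adjoint T"
  shows "inner (T x) y = inner x (T y)"
  using assms by (simp add: self_adjoint_def flip: Re_cinner)

text \<open>Idempotence and self-adjointness turn the squared norm of \<open>T x\<close> into
  \<open>inner x (T x)\<close>; Cauchy-Schwarz finishes.\<close>

lemma projection_operator_contraction:
  assumes "projection_operator T"
  shows "norm (T x) \<le> norm x"
proof -
  have "T (T x) = T x"
    using assms unfolding projection_operator_def by (metis blinfun_apply_blinfun_compose)
  then have "norm (T x) * norm (T x) = inner x (T x)"
    using assms self_adjoint_inner[of T x "T x"]
    by (simp add: projection_operator_def power2_eq_square flip: power2_norm_eq_inner)
  also have "\<dots> \<le> norm x * norm (T x)" by (rule norm_cauchy_schwarz)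
  finally show ?thesis
    by (cases "norm (T x) = 0") auto
qed

lemma complex_linear_strong_limit:
  assumes lim: "\<And>v. ((\<lambda>i. blinfun_apply (T i) v) \<longlongrightarrow> blinfun_apply S v) N"
    and lin: "\<forall>\<^sub>F i in N. complex_linear (T i)" and N: "N \<noteq> bot"
  shows "complex_linear S"
  unfolding complex_linear_def
proof (intro allI)
  fix c x
  have "((\<lambda>i. c *\<^sub>C T i x) \<longlongrightarrow> c *\<^sub>C S x) N"
    using bounded_linear.tendsto[OF bounded_linear_scaleC lim] .
  moreover have "\<forall>\<^sub>F i in N. c *\<^sub>C T i x = T i (c *\<^sub>C x)"
    using lin by eventually_elim (simp add: complex_linear_def)
  ultimately have "((\<lambda>i. T i (c *\<^sub>C x)) \<longlongrightarrow> c *\<^sub>C S x) N"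
    by (rule Lim_transform_eventually)
  then show "S (c *\<^sub>C x) = c *\<^sub>C S x" using tendsto_unique[OF N lim] by blast
qed

text \<open>Symmetry for the real inner product passes to the limit by continuity; complex linearity
  of \<open>S\<close> then upgrades it to the complex inner product.\<close>

lemma self_adjoint_strong_limit:
  assumes lim: "\<And>v. ((\<lambda>i. blinfun_apply (T i) v) \<longlongrightarrow> blinfun_apply S v) N"
    and lin: "complex_linear S"
    and sa: "\<forall>\<^sub>F i in N. self_adjoint (T i)" and N: "N \<noteq> bot"
  shows "self_adjoint S"
proof (rule self_adjoint_if_inner[OF lin])
  fix x y
  have "((\<lambda>i. inner (T i x) y) \<longlongrightarrow> inner (S x) y) N"
    by (intro tendsto_intros lim)
  moreover have "\<forall>\<^sub>F i in N. inner (T i x) y = inner x (T i y)"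
    using sa by eventually_elim (rule self_adjoint_inner)
  ultimately have "((\<lambda>i. inner x (T i y)) \<longlongrightarrow> inner (S x) y) N"
    by (rule Lim_transform_eventually)
  moreover have "((\<lambda>i. inner x (T i y)) \<longlongrightarrow> inner x (S y)) N"
    by (intro tendsto_intros lim)
  ultimately show "inner (S x) y = inner x (S y)" using tendsto_unique[OF N] by blast
qed


section \<open>Measurable locally finite partitions\<close>

context coarse_space
begin

lemma coarsely_bounded_if_controlled:
  "F \<in> \<E> \<Longrightarrow> controlled_by F A \<Longrightarrow> coarsely_bounded \<E> A"
  unfolding controlled_by_def coarsely_bounded_def using subset_closed by blast

text \<open>Any two points of the thickening are joined by a chain: along \<open>G\<close> into
  \<open>A\<close>, across \<open>A \<times> A\<close>, and out again along the converse of
  \<open>G\<close>.\<close>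

lemma coarsely_bounded_thickening:
  assumes "G \<in> \<E>" "coarsely_bounded \<E> A"
  shows "coarsely_bounded \<E> (thickening G A)"
proof -
  have "thickening G A \<times> thickening G A \<subseteq> G O (A \<times> A) O G\<inverse>"
    unfolding thickening_def by blast
  then show ?thesis
    unfolding coarsely_bounded_def
    by (rule subset_closed[rotated])
      (use assms in \<open>auto simp: coarsely_bounded_def intro!: relcomp_closed converse_closed\<close>)
qed

lemma coarse_gauge_symmetrize:
  assumes "F \<in> \<E>"
  shows "coarse_gauge X \<E> (F \<union> F\<inverse> \<union> Id_on X)"
  unfolding coarse_gauge_def
  using assms by (auto intro!: Un_closed converse_closed diagonal symI)

end

locale partitioned_module = coarse_module X \<E> \<AA> \<rho>
  for X :: "'a set" and \<E> and \<AA> and \<rho> :: "'a set \<Rightarrow> ('h::complex_hilbert_space \<Rightarrow>\<^sub>L 'h)" +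
  fixes P :: "'a set set"
  assumes partition: "controlled_partition X \<E> P"
    and locally_finite: "locally_finite_family X \<E> P"
    and measurable: "P \<subseteq> \<AA>"

lemma (in locally_admissible_module) partitioned_module_ex:
  assumes "controlled_partition X \<E> Q" and lf: "locally_finite_family X \<E> Q"
  obtains P where "partitioned_module X \<E> \<AA> \<rho> P"
proof -
  obtain F where Q: "partition_on X Q" and F: "F \<in> \<E>" "\<And>C. C \<in> Q \<Longrightarrow> controlled_by F C"
    using assms(1) unfolding controlled_partition_def by blast
  obtain G where G: "coarse_gauge X \<E> G"
    and hull: "\<And>B. B \<subseteq> X \<Longrightarrow> coarsely_bounded \<E> B \<Longrightarrow> \<exists>A\<in>\<AA>. B \<subseteq> A \<and> A \<subseteq> thickening G B"
    using locally_admissible by blast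
  have GE: "G \<in> \<E>" "sym G" using G unfolding coarse_gauge_def by auto
  have QX: "C \<subseteq> X" if "C \<in> Q" for C using Q that by (auto simp: partition_on_def)
  have "\<forall>C\<in>Q. \<exists>A\<in>\<AA>. C \<subseteq> A \<and> A \<subseteq> thickening G C"
    by (intro ballI hull QX coarsely_bounded_if_controlled[OF F])
  then obtain B where B: "\<And>C. C \<in> Q \<Longrightarrow> B C \<in> \<AA>" "\<And>C. C \<in> Q \<Longrightarrow> C \<subseteq> B C"
    "\<And>C. C \<in> Q \<Longrightarrow> B C \<subseteq> thickening G C"
    by metis
  have BX: "B C \<subseteq> X" if "C \<in> Q" for C using B(1)[OF that] space_closed by blast
  \<comment> \<open>One entourage serves all hulls, because \<open>F\<close> and \<open>G\<close> do
    not depend on \<open>C\<close>.\<close>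
  have B_contr: "B C \<times> B C \<subseteq> G O F O G\<inverse>" if "C \<in> Q" for C
    using B(3)[OF that] F(2)[OF that] unfolding thickening_def controlled_by_def by blast
  have GFG: "G O F O G\<inverse> \<in> \<E>" using GE F by (intro relcomp_closed converse_closed)
  \<comment> \<open>The hulls inherit local finiteness: by symmetry of \<open>G\<close>, if the hull
    of \<open>C\<close> meets \<open>K\<close>, then \<open>C\<close> itself meets the thickening of
    \<open>K\<close>, which is still bounded.\<close>
  have B_lf: "finite {C \<in> Q. K \<inter> B C \<noteq> {}}" if "K \<subseteq> X" "coarsely_bounded \<E> K" for K
  proof (rule finite_subset)
    show "{C \<in> Q. K \<inter> B C \<noteq> {}} \<subseteq> {C \<in> Q. thickening G K \<inter> C \<noteq> {}}"
    proof
      fix C assume "C \<in> {C \<in> Q. K \<inter> B C \<noteq> {}}"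
      then obtain x where C: "C \<in> Q" and x: "x \<in> K" "x \<in> B C" by blast
      obtain c where "c \<in> C" "(x, c) \<in> G" using B(3)[OF C] x unfolding thickening_def by blast
      then have "c \<in> thickening G K \<inter> C"
        using GE(2) x unfolding thickening_def by (blast dest: symD)
      then show "C \<in> {C \<in> Q. thickening G K \<inter> C \<noteq> {}}" using C by blast
    qed
    have "thickening G K \<subseteq> X" using entourage_subset[OF GE(1)] unfolding thickening_def by blast
    then show "finite {C \<in> Q. thickening G K \<inter> C \<noteq> {}}"
      using lf coarsely_bounded_thickening[OF GE(1) that(2)]
      unfolding locally_finite_family_def by blast
  qed
  \<comment> \<open>The well-order is taken on all sets of the type, not just on \<open>Q\<close>.
    Its strict part \<open>L\<close> is well-founded and compares any two distinct indices.\<close>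
  obtain r :: "'a set rel" where r: "Well_order r" "Field r = UNIV"
    using well_ordering[where 'a = "'a set"] by (elim exE conjE)
  define L where "L = r - Id"
  have wf: "wf L" using r(1) unfolding L_def well_order_on_def by blast
  have "total r" using r unfolding well_order_on_def linear_order_on_def by simp
  then have tot: "(C, D) \<in> L \<or> (D, C) \<in> L" if "C \<noteq> D" for C D
    using that unfolding L_def total_on_def by simp
  define A where "A C = B C - \<Union>{B D |D. D \<in> Q \<and> (D, C) \<in> L}" for C
  have AB: "A C \<subseteq> B C" for C unfolding A_def by blast
  have A_meas: "A C \<in> \<AA>" if C: "C \<in> Q" for C
  proof -
    \<comment> \<open>Infinitely many indices may precede \<open>C\<close>, but the hull of
      \<open>C\<close> is bounded and so meets only finitely many hulls. Subtracting just these
      gives the same set and stays inside the Boolean algebra.\<close>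
    have "finite {D \<in> Q. B C \<inter> B D \<noteq> {}}"
      using B_contr[OF C] unfolding controlled_by_def[symmetric]
      by (intro B_lf BX[OF C] coarsely_bounded_if_controlled[OF GFG])
    then have "finite (B ` {D \<in> Q. (D, C) \<in> L \<and> B C \<inter> B D \<noteq> {}})"
      by (intro finite_imageI) (erule rev_finite_subset, auto)
    then have "\<Union>(B ` {D \<in> Q. (D, C) \<in> L \<and> B C \<inter> B D \<noteq> {}}) \<in> \<AA>"
      using B(1) by (intro finite_Union) auto
    moreover have "A C = B C - \<Union>(B ` {D \<in> Q. (D, C) \<in> L \<and> B C \<inter> B D \<noteq> {}})"
      unfolding A_def by blast
    ultimately show ?thesis using B(1)[OF C] by auto
  qed
  \<comment> \<open>Distinct indices yield disjoint remainders, so two remainders coincide only when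
    both are empty; a partition must not contain the empty set.\<close>
  define P where "P = A ` Q - {{}}"
  have "partition_on X P"
  proof (rule partition_onI)
    show "\<Union>P = X"
    proof
      show "\<Union>P \<subseteq> X" using AB BX unfolding P_def by blast
      show "X \<subseteq> \<Union>P"
      proof
        fix x assume "x \<in> X"
        then obtain C where "C \<in> {C \<in> Q. x \<in> B C}"
          using Q B(2) unfolding partition_on_def by blast
        \<comment> \<open>A point survives the subtraction in the hull of least index among those
          containing it.\<close>
        from wfE_min[OF wf this] obtain D where "D \<in> {C \<in> Q. x \<in> B C}"
          and "\<And>E. (E, D) \<in> L \<Longrightarrow> E \<notin> {C \<in> Q. x \<in> B C}"
          by metis
        then have "x \<in> A D" "D \<in> Q" unfolding A_def by auto
        then show "x \<in> \<Union>P" unfolding P_def by blast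
      qed
    qed
    have "A C \<inter> A D = {}" if "C \<in> Q" "D \<in> Q" "C \<noteq> D" for C D
      using tot[OF that(3)] that unfolding A_def by blast
    then show "disjnt p q" if "p \<in> P" "q \<in> P" "p \<noteq> q" for p q
      using that unfolding P_def disjnt_def by blast
    show "{} \<notin> P" unfolding P_def by blast
  qed
  moreover have "controlled_by (G O F O G\<inverse>) p" if p: "p \<in> P" for p
    using p B_contr AB unfolding P_def controlled_by_def by blast
  moreover have "locally_finite_family X \<E> P"
    unfolding locally_finite_family_def
  proof (intro allI impI)
    fix K assume K: "K \<subseteq> X" "coarsely_bounded \<E> K"
    have "{p \<in> P. K \<inter> p \<noteq> {}} \<subseteq> A ` {C \<in> Q. K \<inter> B C \<noteq> {}}"
      using AB unfolding P_def by blast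
    then show "finite {p \<in> P. K \<inter> p \<noteq> {}}"
      by (rule finite_subset[OF _ finite_imageI[OF B_lf[OF K]]])
  qed
  moreover have "P \<subseteq> \<AA>" using A_meas unfolding P_def by blast
  ultimately show ?thesis
    using GFG by (intro that[of P]) (unfold_locales, auto simp: controlled_partition_def)
qed


section \<open>The extended representation\<close>

context partitioned_module
begin

text \<open>The closure condition of discreteness for \<open>P\<close> forces all these sets into
  any admissible extension of \<open>\<AA>\<close>.\<close>

definition extended_algebra :: "'a set set"
  where "extended_algebra = {C. C \<subseteq> X \<and> (\<forall>A\<in>P. C \<inter> A \<in> \<AA>)}"

text \<open>For \<open>C\<close> in \<open>extended_algebra\<close> the sets in the net are
  measurable, and \<open>extended_rep_limit\<close> shows that the limit exists; for other
  \<open>C\<close> the chosen value carries no meaning.\<close>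

definition extended_rep :: "'a set \<Rightarrow> ('h \<Rightarrow>\<^sub>L 'h)"
  where "extended_rep C = (SOME T. \<forall>v.
    ((\<lambda>F. \<rho> (C \<inter> \<Union>F) v) \<longlongrightarrow> blinfun_apply T v) (finite_subsets_at_top P))"

text \<open>Since a projection fixes exactly its range, this is the union of the ranges of
  \<open>\<rho> (\<Union>F)\<close>, a family directed by inclusion of \<open>F\<close>.\<close>

definition finitely_supported :: "'h set"
  where "finitely_supported = {v. \<exists>F. finite F \<and> F \<subseteq> P \<and> \<rho> (\<Union>F) v = v}"

section \<open>Measurable traces on finite unions, and the enlarged algebra\<close>

lemma partition_on_P: "partition_on X P"
  using partition unfolding controlled_partition_def by blast

lemma finite_Union_measurable: "finite F \<Longrightarrow> F \<subseteq> P \<Longrightarrow> \<Union>F \<in> \<AA>"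
  using measurable by (intro finite_Union) auto

lemma rep_rep:
  "A \<in> \<AA> \<Longrightarrow> B \<in> \<AA> \<Longrightarrow> \<rho> A (\<rho> B v) = \<rho> (A \<inter> B) v"
  by (simp add: rep_Int)

lemma extended_algebra_Int:
  assumes "C \<in> extended_algebra" "finite F" "F \<subseteq> P"
  shows "C \<inter> \<Union>F \<in> \<AA>"
proof -
  have "\<Union>((\<inter>) C ` F) \<in> \<AA>"
    using assms by (intro finite_Union) (auto simp: extended_algebra_def)
  then show ?thesis by (simp only: Int_Union)
qed

lemma extended_algebra_superset: "\<AA> \<subseteq> extended_algebra"
  using measurable space_closed unfolding extended_algebra_def by blast

lemma algebra_extended: "algebra X extended_algebra"
  unfolding algebra_iff_Un
proof (intro conjI ballI)
  have PX: "A \<subseteq> X" if "A \<in> P" for A using that measurable space_closed by blast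
  \<comment> \<open>On each part, the complement has as trace a difference of two measurable
    sets.\<close>
  have *: "(X - C) \<inter> A = A - C \<inter> A" if "A \<in> P" for A C using PX[OF that] by blast
  show "X - C \<in> extended_algebra" if "C \<in> extended_algebra" for C
    using that measurable by (auto simp: extended_algebra_def *)
  show "C \<union> D \<in> extended_algebra" if "C \<in> extended_algebra" "D \<in> extended_algebra" for C D
    using that by (auto simp: extended_algebra_def Int_Un_distrib2)
qed (auto simp: extended_algebra_def)

text \<open>The set is a complex subspace, because two finite supports lie in their union. It
  contains the ranges that span densely by non-degeneracy, so its closure is everything.\<close>

lemma finitely_supported_dense: "closure finitely_supported = UNIV"
proof -
  obtain G where G: "coarse_gauge X \<E> G" and dense:
    "closure (cspan (\<Union>A\<in>{A \<in> \<AA>. controlled_by G A}. range (\<rho> A))) = UNIV"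
    using non_degenerate by blast
  have "complex_vector.subspace finitely_supported"
  proof (rule complex_vector.subspaceI)
    show "0 \<in> finitely_supported"
      unfolding finitely_supported_def by (auto intro!: exI[of _ "{}"] simp: blinfun.zero_right)
    show "c *\<^sub>C v \<in> finitely_supported" if v: "v \<in> finitely_supported" for c v
    proof -
      obtain F where F: "finite F" "F \<subseteq> P" "\<rho> (\<Union>F) v = v"
        using v unfolding finitely_supported_def by blast
      then have "\<rho> (\<Union>F) (c *\<^sub>C v) = c *\<^sub>C v"
        using projection[OF finite_Union_measurable]
        by (simp add: projection_operator_def complex_linear_def)
      then show ?thesis using F unfolding finitely_supported_def by blast
    qed
    show "v + w \<in> finitely_supported"
      if vw: "v \<in> finitely_supported" "w \<in> finitely_supported" for v w
    proof -
      obtain F H where F: "finite F" "F \<subseteq> P" "\<rho> (\<Union>F) v = v"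
        and H: "finite H" "H \<subseteq> P" "\<rho> (\<Union>H) w = w"
        using vw unfolding finitely_supported_def by blast
      have FH: "finite (F \<union> H)" "F \<union> H \<subseteq> P" using F H by auto
      have "\<rho> (\<Union>(F \<union> H)) v = v"
        using rep_rep[OF finite_Union_measurable[OF FH] finite_Union_measurable[OF F(1,2)], of v]
          F(3) by (simp add: Int_absorb1)
      moreover have "\<rho> (\<Union>(F \<union> H)) w = w"
        using rep_rep[OF finite_Union_measurable[OF FH] finite_Union_measurable[OF H(1,2)], of w]
          H(3) by (simp add: Int_absorb1)
      ultimately have "\<rho> (\<Union>(F \<union> H)) (v + w) = v + w" by (simp add: blinfun.add_right)
      then show ?thesis using FH unfolding finitely_supported_def by blast
    qed
  qed
  moreover have "\<rho> A v \<in> finitely_supported" if A: "A \<in> \<AA>" "controlled_by G A" for A v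
  proof -
    \<comment> \<open>The bounded set \<open>A\<close> meets only finitely many parts and is covered
      by them, so their union fixes the range of \<open>\<rho> A\<close>.\<close>
    define F where "F = {C \<in> P. A \<inter> C \<noteq> {}}"
    have AX: "A \<subseteq> X" using A space_closed by blast
    have F: "finite F" "F \<subseteq> P"
      using locally_finite AX A G coarsely_bounded_if_controlled
      unfolding F_def locally_finite_family_def coarse_gauge_def by auto
    have "A \<subseteq> \<Union>F" using AX partition_on_P unfolding F_def partition_on_def by blast
    then have "\<rho> (\<Union>F) (\<rho> A v) = \<rho> A v"
      using rep_rep[OF finite_Union_measurable[OF F] A(1), of v] by (simp add: Int_absorb1)
    then show ?thesis using F unfolding finitely_supported_def by blast
  qed
  ultimately have "cspan (\<Union>A\<in>{A \<in> \<AA>. controlled_by G A}. range (\<rho> A)) \<subseteq> finitely_supported"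
    by (intro complex_vector.span_minimal) auto
  from closure_mono[OF this] dense show ?thesis by (simp add: top_unique)
qed

text \<open>Once \<open>H\<close> contains \<open>F\<close>, intersecting with the union of
  \<open>F\<close> removes all dependence on \<open>H\<close>.\<close>

lemma eventually_rep_compose:
  assumes C: "C \<in> extended_algebra" and F: "finite F" "F \<subseteq> P"
  shows "\<forall>\<^sub>F H in finite_subsets_at_top P. \<rho> (C \<inter> \<Union>H) (\<rho> (\<Union>F) v) = \<rho> (C \<inter> \<Union>F) v"
  unfolding eventually_finite_subsets_at_top
proof (intro exI[of _ F] conjI allI impI)
  fix H assume H: "finite H \<and> F \<subseteq> H \<and> H \<subseteq> P"
  then have "(C \<inter> \<Union>H) \<inter> \<Union>F = C \<inter> \<Union>F" by blast
  then show "\<rho> (C \<inter> \<Union>H) (\<rho> (\<Union>F) v) = \<rho> (C \<inter> \<Union>F) v"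
    using rep_rep[OF extended_algebra_Int[OF C] finite_Union_measurable[OF F]] H by simp
qed (use F in auto)

lemma eventually_projection:
  assumes "C \<in> extended_algebra"
  shows "\<forall>\<^sub>F F in finite_subsets_at_top P. projection_operator (\<rho> (C \<inter> \<Union>F))"
  using assms
  by (intro eventually_finite_subsets_at_top_weakI projection extended_algebra_Int)

lemma extended_rep_limit:
  assumes C: "C \<in> extended_algebra"
  shows "((\<lambda>F. \<rho> (C \<inter> \<Union>F) v) \<longlongrightarrow> extended_rep C v) (finite_subsets_at_top P)"
proof -
  have "\<forall>\<^sub>F F in finite_subsets_at_top P. \<forall>v. norm (\<rho> (C \<inter> \<Union>F) v) \<le> norm v"
    using eventually_projection[OF C] by eventually_elim (simp add: projection_operator_contraction)
  moreover have "\<exists>l. ((\<lambda>F. \<rho> (C \<inter> \<Union>F) d) \<longlongrightarrow> l) (finite_subsets_at_top P)"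
    if d: "d \<in> finitely_supported" for d
  proof -
    obtain F where F: "finite F" "F \<subseteq> P" "\<rho> (\<Union>F) d = d"
      using d unfolding finitely_supported_def by blast
    have "((\<lambda>F. \<rho> (C \<inter> \<Union>F) d) \<longlongrightarrow> \<rho> (C \<inter> \<Union>F) d) (finite_subsets_at_top P)"
      using eventually_rep_compose[OF C F(1,2), of d] F(3) by (intro tendsto_eventually) simp
    then show ?thesis ..
  qed
  ultimately have "\<exists>T. \<forall>v. ((\<lambda>F. \<rho> (C \<inter> \<Union>F) v) \<longlongrightarrow> blinfun_apply T v)
      (finite_subsets_at_top P)"
    by (rule contraction_net_convergent[OF _ finitely_supported_dense _
          finite_subsets_at_top_neq_bot])
  from someI_ex[OF this] show ?thesis unfolding extended_rep_def by blast
qed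

lemma extended_rep_compose:
  assumes C: "C \<in> extended_algebra" and F: "finite F" "F \<subseteq> P"
  shows "extended_rep C (\<rho> (\<Union>F) v) = \<rho> (C \<inter> \<Union>F) v"
  using tendsto_unique[OF finite_subsets_at_top_neq_bot extended_rep_limit[OF C]
      tendsto_eventually[OF eventually_rep_compose[OF C F]]] .

text \<open>Uniqueness principle: a bounded operator is determined on the dense set of finitely
  supported vectors. It reduces the algebraic identities below to identities for
  \<open>\<rho>\<close> on measurable sets.\<close>

lemma eq_extended_repI:
  assumes C: "C \<in> extended_algebra"
    and T: "\<And>F v. finite F \<Longrightarrow> F \<subseteq> P \<Longrightarrow> blinfun_apply T (\<rho> (\<Union>F) v) = \<rho> (C \<inter> \<Union>F) v"
  shows "T = extended_rep C"
proof (rule blinfun_eq_on_dense[OF finitely_supported_dense])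
  fix d assume "d \<in> finitely_supported"
  then obtain F where F: "finite F" "F \<subseteq> P" "\<rho> (\<Union>F) d = d"
    unfolding finitely_supported_def by blast
  show "T d = extended_rep C d"
    using T[OF F(1,2), of d] extended_rep_compose[OF C F(1,2), of d] F(3) by simp
qed

section \<open>Projections, multiplicativity, additivity and strong summation\<close>

lemma extended_rep_extends: "A \<in> \<AA> \<Longrightarrow> extended_rep A = \<rho> A"
  using eq_extended_repI[of A "\<rho> A"] extended_algebra_superset
  by (auto simp: rep_rep finite_Union_measurable)

lemma extended_rep_Int:
  assumes C: "C \<in> extended_algebra" and D: "D \<in> extended_algebra"
  shows "extended_rep (C \<inter> D) = extended_rep C o\<^sub>L extended_rep D"
proof -
  interpret ext: algebra X extended_algebra by (rule algebra_extended)
  have "(extended_rep C o\<^sub>L extended_rep D) (\<rho> (\<Union>F) v) = \<rho> (C \<inter> D \<inter> \<Union>F) v"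
    if F: "finite F" "F \<subseteq> P" for F v
  proof -
    note m = extended_algebra_Int[OF C F] extended_algebra_Int[OF D F] finite_Union_measurable[OF F]
    \<comment> \<open>The factor \<open>\<rho> (\<Union>F)\<close> may be reinserted, as
      \<open>D \<inter> \<Union>F\<close> lies below it; this makes
      \<open>extended_rep_compose\<close> applicable a second time, now for
      \<open>C\<close>.\<close>
    have "extended_rep D (\<rho> (\<Union>F) v) = \<rho> (\<Union>F) (\<rho> (D \<inter> \<Union>F) v)"
      using m extended_rep_compose[OF D F] by (simp add: rep_rep Int_commute Int_left_commute)
    moreover have "(C \<inter> \<Union>F) \<inter> (D \<inter> \<Union>F) = C \<inter> D \<inter> \<Union>F" by blast
    ultimately show ?thesis
      using rep_rep[OF m(1,2)] extended_rep_compose[OF C F]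
      by (simp only: blinfun_apply_blinfun_compose)
  qed
  from eq_extended_repI[OF ext.Int[OF C D] this] show ?thesis by simp
qed

lemma extended_rep_Un:
  assumes C: "C \<in> extended_algebra" and D: "D \<in> extended_algebra"
  shows "extended_rep (C \<union> D) =
    extended_rep C + extended_rep D - (extended_rep C o\<^sub>L extended_rep D)"
proof -
  interpret ext: algebra X extended_algebra by (rule algebra_extended)
  have CD: "C \<inter> D \<in> extended_algebra" using C D by (rule ext.Int)
  \<comment> \<open>With the product rewritten as the operator of \<open>C \<inter> D\<close>, each
    of the three terms is computed by a single use of \<open>extended_rep_compose\<close>.\<close>
  have "(extended_rep C + extended_rep D - extended_rep (C \<inter> D)) (\<rho> (\<Union>F) v) =
      \<rho> ((C \<union> D) \<inter> \<Union>F) v"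
    if F: "finite F" "F \<subseteq> P" for F v
  proof -
    note m = extended_algebra_Int[OF C F] extended_algebra_Int[OF D F]
    have "(C \<inter> \<Union>F) \<inter> (D \<inter> \<Union>F) = C \<inter> D \<inter> \<Union>F" by blast
    then show ?thesis
      using rep_Un[OF m] rep_Int[OF m] extended_rep_compose[OF _ F] C D CD
      by (simp add: Int_Un_distrib2 blinfun.add_left blinfun.diff_left)
  qed
  from eq_extended_repI[OF ext.Un[OF C D] this] show ?thesis
    using extended_rep_Int[OF C D] by simp
qed

text \<open>Complex linearity and self-adjointness come from the strong limit; idempotence is
  multiplicativity applied to \<open>C\<close> and itself.\<close>

lemma projection_extended_rep:
  assumes C: "C \<in> extended_algebra"
  shows "projection_operator (extended_rep C)"
proof -
  note ev = eventually_projection[OF C]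
  have lin: "complex_linear (extended_rep C)"
    by (rule complex_linear_strong_limit[OF extended_rep_limit[OF C]])
      (use ev in \<open>auto elim!: eventually_mono simp: projection_operator_def\<close>)
  have "self_adjoint (extended_rep C)"
    by (rule self_adjoint_strong_limit[OF extended_rep_limit[OF C] lin])
      (use ev in \<open>auto elim!: eventually_mono simp: projection_operator_def\<close>)
  then show ?thesis
    using lin extended_rep_Int[OF C C] unfolding projection_operator_def by simp
qed

text \<open>By disjointness the partial sum over \<open>F\<close> is
  \<open>\<rho> (\<Union>F) v\<close>. This is the net defining the operator of \<open>X\<close>,
  whose limit is the identity.\<close>

lemma extended_rep_has_sum: "((\<lambda>A. extended_rep A v) has_sum v) P"
proof -
  have sum: "(\<Sum>A\<in>F. \<rho> A v) = \<rho> (\<Union>F) v" if "finite F" "F \<subseteq> P" for F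
    using that
  proof (induction F rule: finite_induct)
    case (insert A F)
    have "A \<inter> B = {}" if B: "B \<in> F" for B
      by (rule disjointD[OF partition_onD2[OF partition_on_P]]) (use insert B in auto)
    then have "A \<inter> \<Union>F = {}" by blast
    moreover have "A \<in> \<AA>" "\<Union>F \<in> \<AA>"
      using insert measurable finite_Union_measurable by auto
    ultimately show ?case
      using insert rep_Un[of A "\<Union>F"] rep_Int[of A "\<Union>F"]
      by (simp add: rep_empty blinfun.add_left)
  qed (simp add: rep_empty)
  have "X \<in> extended_algebra" using extended_algebra_superset top by blast
  then have "((\<lambda>F. \<rho> (X \<inter> \<Union>F) v) \<longlongrightarrow> v) (finite_subsets_at_top P)"
    using extended_rep_limit[of X v] extended_rep_extends[OF top] by (simp add: rep_space)
  moreover have "\<forall>\<^sub>F F in finite_subsets_at_top P. \<rho> (X \<inter> \<Union>F) v = (\<Sum>A\<in>F. extended_rep A v)"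
  proof (rule eventually_finite_subsets_at_top_weakI)
    fix F assume F: "finite F" "F \<subseteq> P"
    then have "X \<inter> \<Union>F = \<Union>F" using measurable space_closed by blast
    moreover have "(\<Sum>A\<in>F. extended_rep A v) = (\<Sum>A\<in>F. \<rho> A v)"
      using F measurable by (intro sum.cong) (auto simp: extended_rep_extends)
    ultimately show "\<rho> (X \<inter> \<Union>F) v = (\<Sum>A\<in>F. extended_rep A v)" using sum[OF F] by simp
  qed
  ultimately show ?thesis
    unfolding has_sum_def by (rule Lim_transform_eventually)
qed

section \<open>Non-degeneracy and discreteness of the extension\<close>

lemma coarse_module_extended: "coarse_module X \<E> extended_algebra extended_rep"
proof -
  interpret ext: algebra X extended_algebra by (rule algebra_extended)
  show ?thesis
  proof
    obtain G where G: "coarse_gauge X \<E> G" and dense: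
      "closure (cspan (\<Union>A\<in>{A \<in> \<AA>. controlled_by G A}. range (\<rho> A))) = UNIV"
      using non_degenerate by blast
    \<comment> \<open>The original gauge still works, since enlarging the algebra only adds ranges
      to the spanning family.\<close>
    have "(\<Union>A\<in>{A \<in> \<AA>. controlled_by G A}. range (\<rho> A)) \<subseteq>
        (\<Union>A\<in>{A \<in> extended_algebra. controlled_by G A}. range (extended_rep A))"
      using extended_algebra_superset by (auto simp: extended_rep_extends)
    from closure_mono[OF complex_vector.span_mono[OF this]] dense
    have "closure (cspan (\<Union>A\<in>{A \<in> extended_algebra. controlled_by G A}.
            range (extended_rep A))) = UNIV" by (simp add: top_unique)
    with G show "\<exists>G. coarse_gauge X \<E> G \<and>
      closure (cspan (\<Union>A\<in>{A \<in> extended_algebra. controlled_by G A}.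
        range (extended_rep A))) = UNIV" by blast
    show "extended_rep {} = 0" "extended_rep X = id_blinfun"
      by (simp_all add: extended_rep_extends rep_empty rep_space)
  qed (fact projection_extended_rep extended_rep_Int extended_rep_Un)+
qed

lemma discrete_module_extended: "discrete_module X \<E> extended_algebra extended_rep"
proof -
  interpret ext: coarse_module X \<E> extended_algebra extended_rep
    by (rule coarse_module_extended)
  obtain F where F: "F \<in> \<E>" "\<And>C. C \<in> P \<Longrightarrow> controlled_by F C"
    using partition unfolding controlled_partition_def by blast
  \<comment> \<open>The entourage controlling \<open>P\<close> need not be a gauge, so it is made
    symmetric and given the diagonal.\<close>
  let ?G = "F \<union> F\<inverse> \<union> Id_on X"
  have "C \<in> extended_algebra"
    if CX: "C \<subseteq> X" and C: "\<And>A. A \<in> P \<Longrightarrow> C \<inter> A \<in> extended_algebra" for C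
  proof -
    \<comment> \<open>Membership of \<open>C \<inter> A\<close> in the enlarged algebra, tested on
      the part \<open>A\<close> itself, already says that the trace lies in \<open>\<AA>\<close>;
      enlarging twice adds nothing.\<close>
    have "C \<inter> A \<inter> A \<in> \<AA>" if A: "A \<in> P" for A
      using C[OF A] A unfolding extended_algebra_def by blast
    then show ?thesis using CX by (simp add: extended_algebra_def Int_assoc)
  qed
  moreover have "controlled_by ?G C" if "C \<in> P" for C
    using F(2)[OF that] unfolding controlled_by_def by blast
  moreover have "P \<subseteq> extended_algebra" using measurable extended_algebra_superset by blast
  ultimately show ?thesis
    using coarse_gauge_symmetrize[OF F(1)] partition_on_P extended_rep_has_sum
    by unfold_locales (intro exI[of _ ?G] exI[of _ P] conjI ballI allI impI; simp)
qed

end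

theorem proposition4p23:
  fixes X :: "'a set" and \<E> :: "('a \<times> 'a) set set" and \<AA> :: "'a set set"
    and \<rho> :: "'a set \<Rightarrow> ('h::complex_hilbert_space \<Rightarrow>\<^sub>L 'h)"
  assumes "coarsely_locally_finite_space X \<E>"
    and "locally_admissible_module X \<E> \<AA> \<rho>"
  shows "\<exists>\<AA>' (\<rho>' :: 'a set \<Rightarrow> ('h \<Rightarrow>\<^sub>L 'h)).
    \<AA> \<subseteq> \<AA>' \<and> (\<forall>A\<in>\<AA>. \<rho>' A = \<rho> A) \<and> discrete_module X \<E> \<AA>' \<rho>'"
proof -
  obtain Q where "controlled_partition X \<E> Q" "locally_finite_family X \<E> Q"
    using coarsely_locally_finite_space.locally_finite_partition[OF assms(1)] by blast
  then obtain P where "partitioned_module X \<E> \<AA> \<rho> P"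
    using locally_admissible_module.partitioned_module_ex[OF assms(2)] by blast
  then interpret partitioned_module X \<E> \<AA> \<rho> P .
  show ?thesis
    using extended_algebra_superset extended_rep_extends discrete_module_extended by blast
qed

end
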